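(* Let $\triangle ABC$ be a triangle and let $A_1,A_2$ on the line $BC$, $B_1,B_2$ on the line $CA$, $C_1,C_2$ on the line $AB$ be six points lying on the same conic $\mathcal{C}$. With the points $A_3,A_4,B_3,B_4,C_3,C_4,D_3,D_4,E_3,E_4,F_3,F_4$ defined in the context, each of the following 4 sextuples consists of points lying on the same conic: $(D_3,D_4,E_3,E_4,F_3,F_4)$, $(A_3,A_4,B_3,B_4,F_3,F_4)$, $(A_3,A_4,E_3,E_4,C_3,C_4)$ and $(D_3,D_4,B_3,B_4,C_3,C_4)$.
   Context: The setting is the real projective plane (containing the Euclidean plane). The six points $A_1,A_2,B_1,B_2,C_1,C_2$ are distinct and different from the vertices $A,B,C$. A conic is the zero locus of a nonzero quadratic form in homogeneous coordinates (degenerate conics are allowed). Let $D_1, D_2, E_1, E_2, F_1, F_2$ be the second intersection points of the conic $\mathcal{C}$ with the lines $AA_1$, $AA_2$, $BB_1$, $BB_2$, $CC_1$, $CC_2$, respectively. Define $$A_3 = C_1B_2\cap E_1F_2,\quad A_4 = B_1C_2\cap F_1E_2,$$ $$B_3 = A_1C_2\cap F_1D_2,\quad B_4 = C_1A_2\cap D_1F_2,$$ $$C_3 = B_1A_2\cap D_1E_2,\quad C_4 = A_1B_2\cap E_1D_2,$$ $$D_3 = B_1C_1\cap E_2F_2,\quad D_4 = B_2C_2\cap E_1F_1,$$ $$E_3 = A_1C_1\cap D_2F_2,\quad E_4 = A_2C_2\cap D_1F_1,$$ $$F_3 = A_1B_1\cap D_2E_2,\quad F_4 = A_2B_2\cap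 D_1E_1,$$ where $PQ\cap RS$ denotes the intersection point of the lines $PQ$ and $RS$. All these points are assumed to be well defined. *)

theory Defs
  imports "HOL-Analysis.Analysis"
begin

text \<open>Points of the real projective plane are the one-dimensional subspaces of \<open>\<real>\<^sup>3\<close>;
  the nonzero vectors in such a subspace are the homogeneous coordinates of the point.\<close>

typedef proj_point = "{L :: (real^3) set. subspace L \<and> dim L = 1}"
  morphisms subspace_of Proj_point
proof
  show "span {axis 1 1 :: real^3} \<in> {L. subspace L \<and> dim L = 1}"
    by (simp add: dim_singleton axis_eq_0_iff)
qed

text \<open>A line in the projective plane only if \<open>P \<noteq> Q\<close>: for \<open>P = Q\<close> this is \<open>{P}\<close>.\<close>

definition line_through :: "proj_point \<Rightarrow> proj_point \<Rightarrow> proj_point set" where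
  "line_through P Q = {X. subspace_of X \<subseteq> span (subspace_of P \<union> subspace_of Q)}"

definition proj_triangle :: "proj_point \<Rightarrow> proj_point \<Rightarrow> proj_point \<Rightarrow> bool" where
  "proj_triangle A B C \<longleftrightarrow> A \<noteq> B \<and> C \<notin> line_through A B"

definition quadratic_form :: "(real^3 \<Rightarrow> real) \<Rightarrow> bool" where
  "quadratic_form q \<longleftrightarrow> (\<exists>b. bilinear b \<and> (\<forall>v. q v = b v v))"

definition proj_conic :: "proj_point set \<Rightarrow> bool" where
  "proj_conic K \<longleftrightarrow> (\<exists>q. quadratic_form q \<and> (\<exists>v. q v \<noteq> 0) \<and>
     K = {P. \<forall>v \<in> subspace_of P. q v = 0})"

definition coconic :: "proj_point set \<Rightarrow> bool" where
  "coconic S \<longleftrightarrow> (\<exists>K. proj_conic K \<and> S \<subseteq> K)"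

text \<open>\<open>X\<close> is the well-defined intersection point of the lines \<open>PQ\<close> and \<open>RS\<close>: both lines exist
  and they are different.\<close>

definition meet_at :: "proj_point \<Rightarrow> proj_point \<Rightarrow> proj_point \<Rightarrow> proj_point \<Rightarrow> proj_point \<Rightarrow> bool" where
  "meet_at P Q R S X \<longleftrightarrow> P \<noteq> Q \<and> R \<noteq> S \<and> line_through P Q \<inter> line_through R S = {X}"

text \<open>\<open>X\<close> is the second intersection point, besides \<open>Q\<close>, of the conic \<open>K\<close> with the line \<open>PQ\<close>.
  If the line is tangent at \<open>Q\<close> (\<open>Q\<close> is a double intersection, so the only one), this gives
  \<open>X = Q\<close>. A line contained in \<open>K\<close> has no second intersection point, since the line is infinite.\<close>

definition second_intersection ::
  "proj_point set \<Rightarrow> proj_point \<Rightarrow> proj_point \<Rightarrow> proj_point \<Rightarrow> bool" where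
  "second_intersection K P Q X \<longleftrightarrow> P \<noteq> Q \<and> line_through P Q \<inter> K = {Q, X}"

end

theory Submission
  imports Defs
begin

text \<open>The twelve points \<open>A3, \<dots>, F4\<close> lie on the sides of the triangle by Pascal's theorem, and each
  of the sextuples has two points on every side; so the converse of Carnot's theorem applies.

  Take \<open>D3 = B1C1 \<inter> E2F2\<close>. In the hexagon \<open>C1 C2 F2 E2 B2 B1\<close> inscribed in the conic, the opposite
  sides \<open>C1C2\<close> and \<open>E2B2\<close> meet in \<open>B\<close>, the opposite sides \<open>C2F2\<close> and \<open>B2B1\<close> meet in \<open>C\<close>, and the
  remaining two meet in \<open>D3\<close>. By Pascal's theorem \<open>D3\<close> lies on \<open>BC\<close>. By relabelling,
  \<open>D3, D4\<close> are on \<open>BC\<close>, \<open>E3, E4\<close> on \<open>CA\<close> and \<open>F3, F4\<close> on \<open>AB\<close>.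

  Let \<open>a, b, c\<close> be homogeneous coordinates of the vertices and write
  \<open>Ai = b + \<alpha>i c\<close>, \<open>Bi = c + \<beta>i a\<close>, \<open>Ci = a + \<gamma>i b\<close>. Restricting the conic to the three sides and using
  Vieta's formulas gives Carnot's relation \<open>\<alpha>1 \<alpha>2 \<beta>1 \<beta>2 \<gamma>1 \<gamma>2 = 1\<close>. The point where \<open>B1C1\<close> meets \<open>BC\<close>
  is \<open>b - c / (\<beta>1 \<gamma>1)\<close> (Menelaus), so this is \<open>D3\<close>
  (\<open>pascal_meet_on_side\<close>), and similarly for the other five points. In the product of
  their six parameters each \<open>\<alpha>i, \<beta>i, \<gamma>i\<close> occurs twice in the denominator; hence this product is \<open>1\<close>
  as well, and the converse of Carnot's theorem (\<open>carnot_converse\<close>) yields the conic.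

  The other three sextuples need no new argument: exchanging \<open>C1, F1\<close> with \<open>C2, F2\<close> turns \<open>D3, D4, E3, E4\<close>
  into \<open>A4, A3, B3, B4\<close> and fixes \<open>F3, F4\<close>, and the exchanges for \<open>B\<close> and \<open>A\<close> give the remaining two.\<close>

section \<open>Homogeneous coordinates\<close>

definition point_of :: "real^3 \<Rightarrow> proj_point" where
  "point_of v = Proj_point (span {v})"

lemma subspace_of_point_of:
  assumes "v \<noteq> 0"
  shows "subspace_of (point_of v) = span {v}"
  using assms by (simp add: point_of_def Proj_point_inverse dim_singleton)

lemma obtain_coordinates:
  obtains v where "v \<noteq> 0" "P = point_of v"
proof -
  have sub: "subspace (subspace_of P)" and dim: "dim (subspace_of P) = 1"
    using subspace_of[of P] by auto
  obtain B where B: "B \<subseteq> subspace_of P" "independent B" "subspace_of P \<subseteq> span B" "card B = 1"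
    using basis_exists[of "subspace_of P"] dim by metis
  from \<open>card B = 1\<close> obtain v where v: "B = {v}"
    by (auto simp: card_1_singleton_iff)
  have "subspace_of P = span {v}"
    using B sub v span_minimal by blast
  then have "P = point_of v"
    by (metis point_of_def subspace_of_inverse)
  moreover have "v \<noteq> 0"
    using B(2) v dependent_zero by blast
  ultimately show thesis by (rule that[rotated])
qed

lemma point_of_scaleR:
  assumes "k \<noteq> 0"
  shows "point_of (k *\<^sub>R v) = point_of v"
  using assms by (simp add: point_of_def span_image_scale[of "{v}" "\<lambda>_. k", simplified])

lemma in_span_triple:
  fixes v a b c :: "real^3"
  assumes "v \<in> span {a, b, c}"
  obtains x y z where "v = x *\<^sub>R a + y *\<^sub>R b + z *\<^sub>R c"
proof -
  obtain x y z where "v - x *\<^sub>R a - y *\<^sub>R b - z *\<^sub>R c = 0"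
    using assms by (auto simp: span_breakdown_eq)
  then have "v = x *\<^sub>R a + y *\<^sub>R b + z *\<^sub>R c" by (simp add: diff_diff_eq)
  then show thesis by (rule that)
qed

lemma in_span_pair_iff:
  fixes v p q :: "real^3"
  shows "v \<in> span {p, q} \<longleftrightarrow> (\<exists>x y. v = x *\<^sub>R p + y *\<^sub>R q)"
proof -
  have "v \<in> span {p, q} \<longleftrightarrow> (\<exists>x y. v - x *\<^sub>R p - y *\<^sub>R q = 0)"
    by (simp add: span_breakdown_eq)
  then show ?thesis by (simp add: diff_diff_eq)
qed

lemma point_of_in_line_through_iff:
  assumes "v \<noteq> 0" "p \<noteq> 0" "q \<noteq> 0"
  shows "point_of v \<in> line_through (point_of p) (point_of q)
    \<longleftrightarrow> (\<exists>x y. v = x *\<^sub>R p + y *\<^sub>R q)"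
proof -
  have "span (span {p} \<union> span {q}) = span {p, q}"
    by (rule antisym; rule span_minimal)
      (auto intro: span_base span_mono[THEN subsetD, rotated])
  moreover have "span {v} \<subseteq> span {p, q} \<longleftrightarrow> v \<in> span {p, q}"
    using span_minimal[of "{v}" "span {p, q}"] span_base[of v "{v}"] by auto
  moreover have "v \<in> span {p, q} \<longleftrightarrow> (\<exists>x y. v = x *\<^sub>R p + y *\<^sub>R q)"
    by (rule in_span_pair_iff)
  ultimately show ?thesis
    using assms by (simp add: line_through_def subspace_of_point_of)
qed

lemma line_through_commute: "line_through P Q = line_through Q P"
  by (simp add: line_through_def Un_commute)

lemma meet_at_commute:
  assumes "meet_at P Q R S X"
  shows "meet_at Q P R S X" "meet_at P Q S R X" "meet_at Q P S R X"
  using assms by (auto simp: meet_at_def line_through_commute)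

text \<open>Excluding both reference points makes the parameter finite and nonzero, so no point at infinity of
  the affine parameter has to be treated separately.\<close>

lemma point_on_line_parameter:
  assumes "p \<noteq> 0" "q \<noteq> 0" and "X \<in> line_through (point_of p) (point_of q)"
    and "X \<noteq> point_of p" "X \<noteq> point_of q"
  obtains t where "t \<noteq> 0" "X = point_of (p + t *\<^sub>R q)"
proof -
  obtain v where v: "v \<noteq> 0" "X = point_of v" by (rule obtain_coordinates)
  then obtain x y where xy: "v = x *\<^sub>R p + y *\<^sub>R q"
    using assms point_of_in_line_through_iff by blast
  have x: "x \<noteq> 0"
    using xy v assms(5) point_of_scaleR[of y q] by auto
  have y: "y \<noteq> 0"
    using xy v assms(4) point_of_scaleR[of x p] by auto
  have "v = x *\<^sub>R (p + (y / x) *\<^sub>R q)"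
    using x xy by (simp add: algebra_simps)
  then have "X = point_of (p + (y / x) *\<^sub>R q)"
    using v x point_of_scaleR by metis
  then show thesis using x y by (intro that[of "y / x"]) simp_all
qed

text \<open>Coordinates of the vertices are a basis of \<open>\<real>\<^sup>3\<close>, hence a projective frame in which the
  sides are the coordinate lines.\<close>

lemma proj_triangle_basis:
  assumes "proj_triangle A B C"
  obtains a b c where "A = point_of a" "B = point_of b" "C = point_of c"
    "distinct [a, b, c]" "independent {a, b, c}"
proof -
  obtain a where a: "a \<noteq> 0" "A = point_of a" by (rule obtain_coordinates)
  obtain b where b: "b \<noteq> 0" "B = point_of b" by (rule obtain_coordinates)
  obtain c where c: "c \<noteq> 0" "C = point_of c" by (rule obtain_coordinates)
  have AB: "A \<noteq> B" and C: "C \<notin> line_through A B"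
    using assms by (auto simp: proj_triangle_def)
  have "a \<notin> span {b}"
  proof
    assume "a \<in> span {b}"
    then obtain k where "a = k *\<^sub>R b" by (auto simp: span_singleton)
    with a b AB point_of_scaleR[of k b] show False by auto
  qed
  moreover have "c \<notin> span {a, b}"
  proof
    assume "c \<in> span {a, b}"
    then have "\<exists>x y. c = x *\<^sub>R a + y *\<^sub>R b"
      by (simp add: in_span_pair_iff)
    with C a b c point_of_in_line_through_iff show False by blast
  qed
  ultimately have "independent {c, a, b}" "c \<noteq> a" "c \<noteq> b" "a \<noteq> b"
    using b by (auto simp: independent_insert span_base)
  then show thesis
    using a b c by (intro that[of a b c]) (auto simp: insert_commute)
qed

lemma independent_triple_cycle:
  assumes "distinct [a, b, c]" "independent {a, b, c}"
  shows "distinct [b, c, a]" "independent {b, c, a}"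
  using assms by (auto simp: insert_commute)

lemma independent_triple_coeffs_zero:
  fixes a b c :: "real^3"
  assumes "distinct [a, b, c]" "independent {a, b, c}"
    and "x *\<^sub>R a + y *\<^sub>R b + z *\<^sub>R c = 0"
  shows "x = 0" "y = 0" "z = 0"
proof -
  have "\<forall>u. (\<Sum>v\<in>{a, b, c}. u v *\<^sub>R v) = 0 \<longrightarrow> (\<forall>v\<in>{a, b, c}. u v = 0)"
    using assms(2) by (simp add: independent_explicit)
  from spec[OF this, of "\<lambda>v. if v = a then x else if v = b then y else z"]
  show "x = 0" "y = 0" "z = 0"
    using assms(1,3) by (auto simp: add.assoc split: if_splits)
qed

section \<open>Conics as zero loci of bilinear forms\<close>

text \<open>Conics are handled through a bilinear form \<open>f\<close> that need not be symmetric, so the polarization of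
  the quadratic form \<open>f v v\<close> appears as \<open>f x y + f y x\<close>. On a line the form becomes a quadratic
  polynomial in the parameter \<open>t\<close>.\<close>

lemma bilinear_diag_add:
  fixes f :: "real^3 \<Rightarrow> real^3 \<Rightarrow> real"
  assumes "bilinear f"
  shows "f (x + t *\<^sub>R y) (x + t *\<^sub>R y) = f x x + (f x y + f y x) * t + f y y * t\<^sup>2"
  using assms
  by (simp add: bilinear_ladd bilinear_radd bilinear_lmul bilinear_rmul algebra_simps power2_eq_square)

definition zero_locus :: "(real^3 \<Rightarrow> real^3 \<Rightarrow> real) \<Rightarrow> proj_point set" where
  "zero_locus f = {P. \<forall>v \<in> subspace_of P. f v v = 0}"

lemma proj_conic_iff_zero_locus:
  "proj_conic K \<longleftrightarrow> (\<exists>f. bilinear f \<and> (\<exists>v. f v v \<noteq> 0) \<and> K = zero_locus f)"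
proof
  assume "proj_conic K"
  then obtain q where q: "quadratic_form q" "\<exists>v. q v \<noteq> 0"
    "K = {P. \<forall>v \<in> subspace_of P. q v = 0}"
    unfolding proj_conic_def by blast
  moreover obtain f where "bilinear f" "\<forall>v. q v = f v v"
    using q(1) unfolding quadratic_form_def by blast
  ultimately show "\<exists>f. bilinear f \<and> (\<exists>v. f v v \<noteq> 0) \<and> K = zero_locus f"
    unfolding zero_locus_def by auto
next
  assume "\<exists>f. bilinear f \<and> (\<exists>v. f v v \<noteq> 0) \<and> K = zero_locus f"
  then obtain f where "bilinear f" "\<exists>v. f v v \<noteq> 0" "K = zero_locus f" by blast
  then show "proj_conic K"
    unfolding proj_conic_def quadratic_form_def zero_locus_def
    by (intro exI[of _ "\<lambda>v. f v v"]) auto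
qed

lemma point_of_in_zero_locus_iff:
  assumes "bilinear f" "v \<noteq> 0"
  shows "point_of v \<in> zero_locus f \<longleftrightarrow> f v v = 0"
  using assms
  by (auto simp: zero_locus_def subspace_of_point_of span_singleton bilinear_lmul bilinear_rmul
      intro: bexI[of _ 1] dest: spec[of _ 1])

text \<open>The quadratic equation \<open>f (d + t p) (d + t p) = 0\<close> has the root \<open>t = 0\<close>, so its other root can be read
  off from the coefficients without square roots. The result is the image of \<open>d\<close> under the reflection
  with centre \<open>p\<close> that preserves the quadratic form. Tangency is the case where this root is \<open>0\<close> too.\<close>

lemma second_intersection_eq:
  fixes f :: "real^3 \<Rightarrow> real^3 \<Rightarrow> real"
  assumes f: "bilinear f" and p0: "p \<noteq> 0" and d0: "d \<noteq> 0"
    and p: "f p p \<noteq> 0" and d: "f d d = 0"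
    and X: "second_intersection (zero_locus f) (point_of p) (point_of d) X"
  shows "X = point_of (d + (- (f d p + f p d) / f p p) *\<^sub>R p)"
proof -
  define t where "t = - (f d p + f p d) / f p p"
  let ?L = "line_through (point_of p) (point_of d)"
  have pd: "point_of p \<noteq> point_of d" and L: "?L \<inter> zero_locus f = {point_of d, X}"
    using X by (auto simp: second_intersection_def)
  have nz: "d + s *\<^sub>R p \<noteq> 0" for s
  proof
    assume "d + s *\<^sub>R p = 0"
    then have "d = (- s) *\<^sub>R p" by (simp add: eq_neg_iff_add_eq_0)
    with d0 pd point_of_scaleR[of "- s" p] show False by auto
  qed
  have on: "point_of (d + s *\<^sub>R p) \<in> ?L" for s
    using nz[of s] p0 d0 point_of_in_line_through_iff[of "d + s *\<^sub>R p" p d]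
    by (metis add.commute scaleR_one)
  have val: "f (d + s *\<^sub>R p) (d + s *\<^sub>R p) = s * (s - t) * f p p" for s
    using p d by (simp add: bilinear_diag_add[OF f] t_def field_simps power2_eq_square)
  have "point_of (d + t *\<^sub>R p) \<in> ?L \<inter> zero_locus f"
    using on[of t] val[of t] nz[of t] by (simp add: point_of_in_zero_locus_iff[OF f])
  \<comment> \<open>The second case is tangency: a different \<open>X\<close> would be a third root of the quadratic equation.\<close>
  then consider "X = point_of (d + t *\<^sub>R p)" | "point_of (d + t *\<^sub>R p) = point_of d"
    using L by auto
  then have "X = point_of (d + t *\<^sub>R p)"
  proof cases
    case 2
    show ?thesis
    proof (rule ccontr)
      assume "X \<noteq> point_of (d + t *\<^sub>R p)"
      with 2 have "X \<noteq> point_of d" by simp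
      moreover have "X \<in> ?L" "X \<in> zero_locus f" using L by auto
      moreover have "point_of p \<notin> zero_locus f"
        using p p0 by (simp add: point_of_in_zero_locus_iff[OF f])
      ultimately obtain s where s: "s \<noteq> 0" "X = point_of (d + s *\<^sub>R p)"
        by (metis p0 d0 line_through_commute point_on_line_parameter)
      then have "s = t"
        using val[of s] p nz[of s] \<open>X \<in> zero_locus f\<close> by (simp add: point_of_in_zero_locus_iff[OF f])
      with s \<open>X \<noteq> point_of (d + t *\<^sub>R p)\<close> show False by simp
    qed
  qed simp
  then show ?thesis by (simp add: t_def)
qed

lemma vieta_quadratic:
  fixes u m w s t :: real
  assumes "w + m * s + u * s\<^sup>2 = 0" "w + m * t + u * t\<^sup>2 = 0" "s \<noteq> t"
  shows "m = - u * (s + t)" "w = u * s * t"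
proof -
  have "(s - t) * (m + u * (s + t)) = 0"
    using assms(1,2) by (simp add: algebra_simps power2_eq_square)
  with assms(3) show m: "m = - u * (s + t)" by (simp add: eq_neg_iff_add_eq_0)
  show "w = u * s * t"
    using assms(1) unfolding m by (simp add: algebra_simps power2_eq_square)
qed

section \<open>Pascal and Carnot for an inscribed hexagon on the sides\<close>

text \<open>If the conic passed through the vertex \<open>a\<close>, it would have three points on each of the sides through \<open>a\<close>,
  so it would contain both; being of degree two it would be their union, which does not meet the
  third side outside the vertices.\<close>

lemma vertex_not_on_conic:
  fixes f :: "real^3 \<Rightarrow> real^3 \<Rightarrow> real" and a b c :: "real^3"
  assumes f: "bilinear f" and nz: "\<exists>v. f v v \<noteq> 0"
    and abc: "distinct [a, b, c]" "independent {a, b, c}"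
    and A: "f (b + \<alpha> *\<^sub>R c) (b + \<alpha> *\<^sub>R c) = 0" "\<alpha> \<noteq> 0"
    and B: "f (c + \<beta>1 *\<^sub>R a) (c + \<beta>1 *\<^sub>R a) = 0" "f (c + \<beta>2 *\<^sub>R a) (c + \<beta>2 *\<^sub>R a) = 0" "\<beta>1 \<noteq> \<beta>2"
    and C: "f (a + \<gamma>1 *\<^sub>R b) (a + \<gamma>1 *\<^sub>R b) = 0" "f (a + \<gamma>2 *\<^sub>R b) (a + \<gamma>2 *\<^sub>R b) = 0" "\<gamma>1 \<noteq> \<gamma>2"
    "\<gamma>1 \<noteq> 0" "\<gamma>2 \<noteq> 0"
  shows "f a a \<noteq> 0"
proof
  assume a: "f a a = 0"
  have c: "f c c = 0" "f c a + f a c = 0"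
    using vieta_quadratic[OF B[unfolded bilinear_diag_add[OF f]]] a by auto
  have b: "f b b = 0" "f a b + f b a = 0"
    using vieta_quadratic[OF C(1-3)[unfolded bilinear_diag_add[OF f]]] a C(4,5) by auto
  have bc: "f b c + f c b = 0"
    using A b c by (simp add: bilinear_diag_add[OF f])
  have "card {a, b, c} = 3" using abc(1) by simp
  then have "span {a, b, c} = UNIV"
    using abc(2) card_ge_dim_independent[of "{a, b, c}" UNIV] by auto
  then have "f v v = 0" for v
  proof -
    have "v \<in> span {a, b, c}" using \<open>span {a, b, c} = UNIV\<close> by simp
    then obtain x y z where "v = x *\<^sub>R a + y *\<^sub>R b + z *\<^sub>R c"
      by (rule in_span_triple)
    then have "f v v = f a a * x\<^sup>2 + f b b * y\<^sup>2 + f c c * z\<^sup>2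
        + (f a b + f b a) * x * y + (f b c + f c b) * y * z + (f c a + f a c) * z * x"
      using f by (simp add: bilinear_ladd bilinear_radd bilinear_lmul bilinear_rmul
          algebra_simps power2_eq_square)
    then show ?thesis using a b c bc by simp
  qed
  with nz show False by simp
qed

text \<open>This is Pascal's theorem for the hexagon \<open>C1 C2 F2 E2 B2 B1\<close>, together with the position of the
  intersection point on the side through \<open>b\<close> and \<open>c\<close>. The coordinates of \<open>E\<close> and \<open>F\<close> are explicit by
  \<open>second_intersection_eq\<close>, so it suffices to write the point \<open>b - c / (\<beta>1 \<gamma>1)\<close>, which is visibly
  on \<open>B1C1\<close>, as a combination of them. This computation also covers the
  tangent cases \<open>E = B2\<close> and \<open>F = C2\<close>. The only possible degeneration is \<open>E = F\<close>, which is excluded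
  because \<open>X\<close> is a well-defined intersection.\<close>

lemma pascal_meet_on_side:
  fixes f :: "real^3 \<Rightarrow> real^3 \<Rightarrow> real" and a b c :: "real^3"
  assumes f: "bilinear f"
    and abc: "distinct [a, b, c]" "independent {a, b, c}"
    and vert: "f a a \<noteq> 0" "f b b \<noteq> 0" "f c c \<noteq> 0"
    and B: "f (c + \<beta>1 *\<^sub>R a) (c + \<beta>1 *\<^sub>R a) = 0" "f (c + \<beta>2 *\<^sub>R a) (c + \<beta>2 *\<^sub>R a) = 0" "\<beta>1 \<noteq> \<beta>2"
    and C: "f (a + \<gamma>1 *\<^sub>R b) (a + \<gamma>1 *\<^sub>R b) = 0" "f (a + \<gamma>2 *\<^sub>R b) (a + \<gamma>2 *\<^sub>R b) = 0" "\<gamma>1 \<noteq> \<gamma>2"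
    and E: "second_intersection (zero_locus f) (point_of b) (point_of (c + \<beta>2 *\<^sub>R a)) E"
    and F: "second_intersection (zero_locus f) (point_of c) (point_of (a + \<gamma>2 *\<^sub>R b)) F"
    and X: "meet_at (point_of (c + \<beta>1 *\<^sub>R a)) (point_of (a + \<gamma>1 *\<^sub>R b)) E F X"
  shows "X = point_of (b + (- 1 / (\<beta>1 * \<gamma>1)) *\<^sub>R c)"
proof -
  note frame = independent_triple_coeffs_zero[OF abc]
  have nz: "x *\<^sub>R a + y *\<^sub>R b + z *\<^sub>R c \<noteq> 0" if "x \<noteq> 0 \<or> y \<noteq> 0 \<or> z \<noteq> 0" for x y z
    using frame[of x y z] that by blast
  have vec0: "b \<noteq> 0" "c \<noteq> 0" "\<And>\<beta>. c + \<beta> *\<^sub>R a \<noteq> 0" "\<And>\<gamma>. a + \<gamma> *\<^sub>R b \<noteq> 0"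
    using nz[of 0 1 0] nz[of 0 0 1] nz[of _ 0 1] nz[of 1 _ 0] by (auto simp: add.commute)
  define l where "l = f b c + f c b"
  have fc: "f c a + f a c = - f a a * (\<beta>1 + \<beta>2)" "f c c = f a a * \<beta>1 * \<beta>2"
    using vieta_quadratic[OF B[unfolded bilinear_diag_add[OF f]]] by auto
  have fa: "f a b + f b a = - f b b * (\<gamma>1 + \<gamma>2)" "f a a = f b b * \<gamma>1 * \<gamma>2"
    using vieta_quadratic[OF C[unfolded bilinear_diag_add[OF f]]] by auto
  have coeff: "\<beta>1 \<noteq> 0" "\<beta>2 \<noteq> 0" "\<gamma>1 \<noteq> 0" "\<gamma>2 \<noteq> 0"
    using fc(2) fa(2) vert by auto
  define s where "s = - (l - f b b * (\<gamma>1 + \<gamma>2) * \<beta>2) / f b b"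
  define r where "r = - (l * \<gamma>2 - f a a * (\<beta>1 + \<beta>2)) / f c c"
  define e where "e = c + \<beta>2 *\<^sub>R a + s *\<^sub>R b"
  define g where "g = a + \<gamma>2 *\<^sub>R b + r *\<^sub>R c"
  have "f (c + \<beta>2 *\<^sub>R a) b + f b (c + \<beta>2 *\<^sub>R a) = l + (f a b + f b a) * \<beta>2"
    using f by (simp add: l_def bilinear_ladd bilinear_radd bilinear_lmul bilinear_rmul algebra_simps)
  then have E': "E = point_of e"
    using second_intersection_eq[OF f vec0(1) vec0(3) vert(2) B(2) E] fa(1)
    by (simp add: e_def s_def)
  have "f (a + \<gamma>2 *\<^sub>R b) c + f c (a + \<gamma>2 *\<^sub>R b) = l * \<gamma>2 + (f c a + f a c)"
    using f by (simp add: l_def bilinear_ladd bilinear_radd bilinear_lmul bilinear_rmul algebra_simps)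
  then have F': "F = point_of g"
    using second_intersection_eq[OF f vec0(2) vec0(4) vert(3) C(2) F] fc(1)
    by (simp add: g_def r_def)
  have e0: "e \<noteq> 0" and g0: "g \<noteq> 0"
    using nz[of \<beta>2 s 1] nz[of 1 \<gamma>2 r] by (auto simp: e_def g_def algebra_simps)
  \<comment> \<open>The combination \<open>\<beta>2 g - e\<close> eliminates \<open>a\<close>, so it is where the line \<open>EF\<close> meets the side.\<close>
  define k where "k = \<beta>2 * r - 1"
  have "\<beta>2 * \<gamma>2 - s = - \<beta>1 * \<gamma>1 * k"
    unfolding k_def s_def r_def fc(2) fa(2) using coeff vert(2) by (simp add: field_simps)
  moreover have "\<beta>2 *\<^sub>R g - e = (\<beta>2 * \<gamma>2 - s) *\<^sub>R b + k *\<^sub>R c"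
    by (simp add: e_def g_def k_def algebra_simps)
  ultimately have comb: "\<beta>2 *\<^sub>R g - e = (- \<beta>1 * \<gamma>1 * k) *\<^sub>R b + k *\<^sub>R c"
    by simp
  have k: "k \<noteq> 0"
  proof
    assume "k = 0"
    with comb have "e = \<beta>2 *\<^sub>R g" by simp
    then have "E = F" using E' F' coeff point_of_scaleR by simp
    with X show False by (simp add: meet_at_def)
  qed
  let ?x = "b + (- 1 / (\<beta>1 * \<gamma>1)) *\<^sub>R c"
  have x0: "?x \<noteq> 0" using nz[of 0 1 "- 1 / (\<beta>1 * \<gamma>1)"] by simp
  have "?x = (- 1 / (\<beta>1 * \<gamma>1)) *\<^sub>R (c + \<beta>1 *\<^sub>R a) + (1 / \<gamma>1) *\<^sub>R (a + \<gamma>1 *\<^sub>R b)"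
    using coeff by (simp add: algebra_simps)
  then have "point_of ?x \<in> line_through (point_of (c + \<beta>1 *\<^sub>R a)) (point_of (a + \<gamma>1 *\<^sub>R b))"
    using point_of_in_line_through_iff[OF x0 vec0(3) vec0(4)] by blast
  moreover have "?x = (- 1 / (\<beta>1 * \<gamma>1 * k)) *\<^sub>R (\<beta>2 *\<^sub>R g - e)"
    unfolding comb using coeff k by (simp add: algebra_simps)
  then have "?x = (1 / (\<beta>1 * \<gamma>1 * k)) *\<^sub>R e + (- \<beta>2 / (\<beta>1 * \<gamma>1 * k)) *\<^sub>R g"
    by (simp add: algebra_simps)
  then have "point_of ?x \<in> line_through E F"
    unfolding E' F' using point_of_in_line_through_iff[OF x0 e0 g0] by blast
  ultimately show ?thesis
    using X by (auto simp: meet_at_def)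
qed

text \<open>The conic is written down from its restrictions to the three sides, each of which must be
  a multiple of the polynomial with the prescribed two roots. The coefficients of the squares are shared by two
  sides; going around the triangle they match because the product is \<open>1\<close>.\<close>

lemma carnot_converse:
  fixes a b c :: "real^3"
  assumes abc: "distinct [a, b, c]" "independent {a, b, c}"
    and prod: "\<alpha>1 * \<alpha>2 * \<beta>1 * \<beta>2 * \<gamma>1 * \<gamma>2 = 1"
  shows "coconic {point_of (b + \<alpha>1 *\<^sub>R c), point_of (b + \<alpha>2 *\<^sub>R c),
    point_of (c + \<beta>1 *\<^sub>R a), point_of (c + \<beta>2 *\<^sub>R a),
    point_of (a + \<gamma>1 *\<^sub>R b), point_of (a + \<gamma>2 *\<^sub>R b)}"
proof -
  have dual: "\<exists>h. linear h \<and> (\<forall>v\<in>{a, b, c}. h v = (if v = e then 1 else 0 :: real))" for e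
    by (rule linear_independent_extend[OF abc(2)])
  \<comment> \<open>\<open>X, Y, Z\<close> are the coordinate functions of the frame.\<close>
  obtain X :: "real^3 \<Rightarrow> real" where X: "linear X" "X a = 1" "X b = 0" "X c = 0"
    using dual[of a] abc(1) by auto
  obtain Y :: "real^3 \<Rightarrow> real" where Y: "linear Y" "Y a = 0" "Y b = 1" "Y c = 0"
    using dual[of b] abc(1) by auto
  obtain Z :: "real^3 \<Rightarrow> real" where Z: "linear Z" "Z a = 0" "Z b = 0" "Z c = 1"
    using dual[of c] abc(1) by auto
  \<comment> \<open>With \<open>1\<close> as coefficient of \<open>X\<^sup>2\<close>, Vieta on the side \<open>ca\<close> forces \<open>w\<close> and then Vieta on \<open>bc\<close> forces \<open>v\<close>.\<close>
  define w where "w = \<beta>1 * \<beta>2"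
  define v where "v = w * \<alpha>1 * \<alpha>2"
  define f where "f p q = X p * X q + v * (Y p * Y q) + w * (Z p * Z q)
    - w * (\<alpha>1 + \<alpha>2) * (Y p * Z q) - (\<beta>1 + \<beta>2) * (Z p * X q)
    - v * (\<gamma>1 + \<gamma>2) * (X p * Y q)" for p q
  note lin = linear_add[OF X(1)] linear_scale[OF X(1)] linear_add[OF Y(1)] linear_scale[OF Y(1)]
    linear_add[OF Z(1)] linear_scale[OF Z(1)]
  have f: "bilinear f"
    unfolding bilinear_def
    by (intro conjI allI linearI) (simp_all add: f_def lin ring_distribs)
  have val: "f (x *\<^sub>R a + y *\<^sub>R b + z *\<^sub>R c) (x *\<^sub>R a + y *\<^sub>R b + z *\<^sub>R c) =
    x\<^sup>2 + v * y\<^sup>2 + w * z\<^sup>2 - w * (\<alpha>1 + \<alpha>2) * y * z - (\<beta>1 + \<beta>2) * z * x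
    - v * (\<gamma>1 + \<gamma>2) * x * y" for x y z
    by (simp add: f_def lin X Y Z power2_eq_square)
  \<comment> \<open>The side \<open>ab\<close> closes the cycle; this is where the product hypothesis enters.\<close>
  have vg: "v * \<gamma>1 * \<gamma>2 = 1" using prod by (simp add: v_def w_def mult_ac)
  have mem: "point_of p \<in> zero_locus f" if "p = x *\<^sub>R a + y *\<^sub>R b + z *\<^sub>R c" "x \<noteq> 0 \<or> y \<noteq> 0 \<or> z \<noteq> 0"
    "x\<^sup>2 + v * y\<^sup>2 + w * z\<^sup>2 - w * (\<alpha>1 + \<alpha>2) * y * z - (\<beta>1 + \<beta>2) * z * x
    - v * (\<gamma>1 + \<gamma>2) * x * y = 0" for p x y z
    using independent_triple_coeffs_zero[OF abc, of x y z] that point_of_in_zero_locus_iff[OF f, of p] val[of x y z]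
    by auto
  have "point_of (b + \<alpha>1 *\<^sub>R c) \<in> zero_locus f"
    by (rule mem[of _ 0 1 \<alpha>1]) (simp_all add: v_def algebra_simps power2_eq_square)
  moreover have "point_of (b + \<alpha>2 *\<^sub>R c) \<in> zero_locus f"
    by (rule mem[of _ 0 1 \<alpha>2]) (simp_all add: v_def algebra_simps power2_eq_square)
  moreover have "point_of (c + \<beta>1 *\<^sub>R a) \<in> zero_locus f"
    by (rule mem[of _ \<beta>1 0 1]) (simp_all add: w_def algebra_simps power2_eq_square)
  moreover have "point_of (c + \<beta>2 *\<^sub>R a) \<in> zero_locus f"
    by (rule mem[of _ \<beta>2 0 1]) (simp_all add: w_def algebra_simps power2_eq_square)
  moreover have "point_of (a + \<gamma>1 *\<^sub>R b) \<in> zero_locus f"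
    by (rule mem[of _ 1 \<gamma>1 0]) (use vg in \<open>simp_all add: algebra_simps power2_eq_square\<close>)
  moreover have "point_of (a + \<gamma>2 *\<^sub>R b) \<in> zero_locus f"
    by (rule mem[of _ 1 \<gamma>2 0]) (use vg in \<open>simp_all add: algebra_simps power2_eq_square\<close>)
  moreover have "f a a \<noteq> 0" using val[of 1 0 0] by simp
  ultimately show ?thesis
    using f unfolding coconic_def proj_conic_iff_zero_locus by blast
qed

text \<open>All hypotheses on the conic and the points on the sides are invariant under exchanging the labels
  \<open>1\<close> and \<open>2\<close> on one side. Stated with independent parameters for the six points, the result for one
  sextuple can be relabelled to give the others.\<close>

lemma sextuple_coconic:
  fixes f :: "real^3 \<Rightarrow> real^3 \<Rightarrow> real" and a b c :: "real^3"
  assumes f: "bilinear f"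
    and abc: "distinct [a, b, c]" "independent {a, b, c}"
    and vert: "f a a \<noteq> 0" "f b b \<noteq> 0" "f c c \<noteq> 0"
    and A: "f (b + \<alpha>1 *\<^sub>R c) (b + \<alpha>1 *\<^sub>R c) = 0" "f (b + \<alpha>2 *\<^sub>R c) (b + \<alpha>2 *\<^sub>R c) = 0" "\<alpha>1 \<noteq> \<alpha>2"
    and B: "f (c + \<beta>1 *\<^sub>R a) (c + \<beta>1 *\<^sub>R a) = 0" "f (c + \<beta>2 *\<^sub>R a) (c + \<beta>2 *\<^sub>R a) = 0" "\<beta>1 \<noteq> \<beta>2"
    and C: "f (a + \<gamma>1 *\<^sub>R b) (a + \<gamma>1 *\<^sub>R b) = 0" "f (a + \<gamma>2 *\<^sub>R b) (a + \<gamma>2 *\<^sub>R b) = 0" "\<gamma>1 \<noteq> \<gamma>2"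
    and A1: "A1 = point_of (b + \<alpha>1 *\<^sub>R c)" and A2: "A2 = point_of (b + \<alpha>2 *\<^sub>R c)"
    and B1: "B1 = point_of (c + \<beta>1 *\<^sub>R a)" and B2: "B2 = point_of (c + \<beta>2 *\<^sub>R a)"
    and C1: "C1 = point_of (a + \<gamma>1 *\<^sub>R b)" and C2: "C2 = point_of (a + \<gamma>2 *\<^sub>R b)"
    and D: "second_intersection (zero_locus f) (point_of a) A1 D1"
      "second_intersection (zero_locus f) (point_of a) A2 D2"
    and E: "second_intersection (zero_locus f) (point_of b) B1 E1"
      "second_intersection (zero_locus f) (point_of b) B2 E2"
    and F: "second_intersection (zero_locus f) (point_of c) C1 F1"
      "second_intersection (zero_locus f) (point_of c) C2 F2"
    and D': "meet_at B1 C1 E2 F2 D3" "meet_at B2 C2 E1 F1 D4"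
    and E': "meet_at A1 C1 D2 F2 E3" "meet_at A2 C2 D1 F1 E4"
    and F': "meet_at A1 B1 D2 E2 F3" "meet_at A2 B2 D1 E1 F4"
  shows "coconic {D3, D4, E3, E4, F3, F4}"
proof -
  note abc' = independent_triple_cycle[OF abc]
  note abc'' = independent_triple_cycle[OF abc']
  have D3: "D3 = point_of (b + (- 1 / (\<beta>1 * \<gamma>1)) *\<^sub>R c)"
    using pascal_meet_on_side[OF f abc vert B C] E(2) F(2) D'(1) B1 B2 C1 C2 by simp
  have D4: "D4 = point_of (b + (- 1 / (\<beta>2 * \<gamma>2)) *\<^sub>R c)"
    using pascal_meet_on_side[OF f abc vert B(2,1) B(3)[symmetric] C(2,1) C(3)[symmetric]]
      E(1) F(1) D'(2) B1 B2 C1 C2 by simp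
  have E3: "E3 = point_of (c + (- 1 / (\<gamma>1 * \<alpha>1)) *\<^sub>R a)"
    using pascal_meet_on_side[OF f abc' vert(2,3,1) C A] F(2) D(2) meet_at_commute(3)[OF E'(1)] C1 C2 A1 A2 by simp
  have E4: "E4 = point_of (c + (- 1 / (\<gamma>2 * \<alpha>2)) *\<^sub>R a)"
    using pascal_meet_on_side[OF f abc' vert(2,3,1) C(2,1) C(3)[symmetric] A(2,1) A(3)[symmetric]]
      F(1) D(1) meet_at_commute(3)[OF E'(2)] C1 C2 A1 A2 by simp
  have F3: "F3 = point_of (a + (- 1 / (\<alpha>1 * \<beta>1)) *\<^sub>R b)"
    using pascal_meet_on_side[OF f abc'' vert(3,1,2) A B] D(2) E(2) F'(1) A1 A2 B1 B2 by simp
  have F4: "F4 = point_of (a + (- 1 / (\<alpha>2 * \<beta>2)) *\<^sub>R b)"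
    using pascal_meet_on_side[OF f abc'' vert(3,1,2) A(2,1) A(3)[symmetric] B(2,1) B(3)[symmetric]]
      D(1) E(1) F'(2) A1 A2 B1 B2 by simp
  \<comment> \<open>Carnot's relation for the given conic: Vieta on each side, multiplied around the triangle.\<close>
  have "f b b = f c c * \<alpha>1 * \<alpha>2" "f c c = f a a * \<beta>1 * \<beta>2" "f a a = f b b * \<gamma>1 * \<gamma>2"
    using vieta_quadratic(2)[OF A[unfolded bilinear_diag_add[OF f]]]
      vieta_quadratic(2)[OF B[unfolded bilinear_diag_add[OF f]]]
      vieta_quadratic(2)[OF C[unfolded bilinear_diag_add[OF f]]] by auto
  then have "f a a = f a a * (\<alpha>1 * \<alpha>2 * \<beta>1 * \<beta>2 * \<gamma>1 * \<gamma>2)"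
    by (simp add: mult_ac)
  then have carnot: "\<alpha>1 * \<alpha>2 * \<beta>1 * \<beta>2 * \<gamma>1 * \<gamma>2 = 1"
    using vert(1) by simp
  have "(- 1 / (\<beta>1 * \<gamma>1)) * (- 1 / (\<beta>2 * \<gamma>2)) * (- 1 / (\<gamma>1 * \<alpha>1)) * (- 1 / (\<gamma>2 * \<alpha>2))
      * (- 1 / (\<alpha>1 * \<beta>1)) * (- 1 / (\<alpha>2 * \<beta>2)) = 1 / (\<alpha>1 * \<alpha>2 * \<beta>1 * \<beta>2 * \<gamma>1 * \<gamma>2)\<^sup>2"
    by (simp add: power2_eq_square mult_ac)
  with carnot have "(- 1 / (\<beta>1 * \<gamma>1)) * (- 1 / (\<beta>2 * \<gamma>2)) * (- 1 / (\<gamma>1 * \<alpha>1)) * (- 1 / (\<gamma>2 * \<alpha>2))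
      * (- 1 / (\<alpha>1 * \<beta>1)) * (- 1 / (\<alpha>2 * \<beta>2)) = 1"
    by simp
  from carnot_converse[OF abc this] show ?thesis
    unfolding D3 D4 E3 E4 F3 F4 .
qed

section \<open>The four conics\<close>

theorem theorem2p4:
  fixes A B C A1 A2 B1 B2 C1 C2 D1 D2 E1 E2 F1 F2
    A3 A4 B3 B4 C3 C4 D3 D4 E3 E4 F3 F4 :: proj_point
    and K :: "proj_point set"
  assumes "proj_triangle A B C"
    and "A1 \<in> line_through B C" "A2 \<in> line_through B C"
    and "B1 \<in> line_through C A" "B2 \<in> line_through C A"
    and "C1 \<in> line_through A B" "C2 \<in> line_through A B"
    and "distinct [A1, A2, B1, B2, C1, C2]"
    and "{A1, A2, B1, B2, C1, C2} \<inter> {A, B, C} = {}"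
    and "proj_conic K" "{A1, A2, B1, B2, C1, C2} \<subseteq> K"
    and "second_intersection K A A1 D1" "second_intersection K A A2 D2"
    and "second_intersection K B B1 E1" "second_intersection K B B2 E2"
    and "second_intersection K C C1 F1" "second_intersection K C C2 F2"
    and "meet_at C1 B2 E1 F2 A3" "meet_at B1 C2 F1 E2 A4"
    and "meet_at A1 C2 F1 D2 B3" "meet_at C1 A2 D1 F2 B4"
    and "meet_at B1 A2 D1 E2 C3" "meet_at A1 B2 E1 D2 C4"
    and "meet_at B1 C1 E2 F2 D3" "meet_at B2 C2 E1 F1 D4"
    and "meet_at A1 C1 D2 F2 E3" "meet_at A2 C2 D1 F1 E4"
    and "meet_at A1 B1 D2 E2 F3" "meet_at A2 B2 D1 E1 F4"
  shows "coconic {D3, D4, E3, E4, F3, F4} \<and>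
    coconic {A3, A4, B3, B4, F3, F4} \<and>
    coconic {A3, A4, E3, E4, C3, C4} \<and>
    coconic {D3, D4, B3, B4, C3, C4}"
proof -
  obtain a b c where vA: "A = point_of a" and vB: "B = point_of b" and vC: "C = point_of c"
    and abc: "distinct [a, b, c]" "independent {a, b, c}"
    using \<open>proj_triangle A B C\<close> by (rule proj_triangle_basis)
  obtain f where f: "bilinear f" "\<exists>v. f v v \<noteq> 0" and K: "K = zero_locus f"
    using \<open>proj_conic K\<close> proj_conic_iff_zero_locus by blast
  have vec0: "x *\<^sub>R a + y *\<^sub>R b + z *\<^sub>R c \<noteq> 0" if "x \<noteq> 0 \<or> y \<noteq> 0 \<or> z \<noteq> 0" for x y z
    using independent_triple_coeffs_zero[OF abc, of x y z] that by blast
  have a0: "a \<noteq> 0" "\<And>t. b + t *\<^sub>R c \<noteq> 0" and b0: "b \<noteq> 0" "\<And>t. c + t *\<^sub>R a \<noteq> 0"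
    and c0: "c \<noteq> 0" "\<And>t. a + t *\<^sub>R b \<noteq> 0"
    using vec0[of 1 0 0] vec0[of 0 1] vec0[of 0 1 0] vec0[of _ 0 1] vec0[of 0 0 1] vec0[of 1 _ 0]
    by (auto simp: add.commute)
  obtain \<alpha>1 where \<alpha>1: "\<alpha>1 \<noteq> 0" "A1 = point_of (b + \<alpha>1 *\<^sub>R c)"
    using point_on_line_parameter[OF b0(1) c0(1), of A1] assms(2,9) vB vC by auto
  obtain \<alpha>2 where \<alpha>2: "\<alpha>2 \<noteq> 0" "A2 = point_of (b + \<alpha>2 *\<^sub>R c)"
    using point_on_line_parameter[OF b0(1) c0(1), of A2] assms(3,9) vB vC by auto
  obtain \<beta>1 where \<beta>1: "\<beta>1 \<noteq> 0" "B1 = point_of (c + \<beta>1 *\<^sub>R a)"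
    using point_on_line_parameter[OF c0(1) a0(1), of B1] assms(4,9) vC vA by auto
  obtain \<beta>2 where \<beta>2: "\<beta>2 \<noteq> 0" "B2 = point_of (c + \<beta>2 *\<^sub>R a)"
    using point_on_line_parameter[OF c0(1) a0(1), of B2] assms(5,9) vC vA by auto
  obtain \<gamma>1 where \<gamma>1: "\<gamma>1 \<noteq> 0" "C1 = point_of (a + \<gamma>1 *\<^sub>R b)"
    using point_on_line_parameter[OF a0(1) b0(1), of C1] assms(6,9) vA vB by auto
  obtain \<gamma>2 where \<gamma>2: "\<gamma>2 \<noteq> 0" "C2 = point_of (a + \<gamma>2 *\<^sub>R b)"
    using point_on_line_parameter[OF a0(1) b0(1), of C2] assms(7,9) vA vB by auto
  have A: "f (b + \<alpha>1 *\<^sub>R c) (b + \<alpha>1 *\<^sub>R c) = 0" "f (b + \<alpha>2 *\<^sub>R c) (b + \<alpha>2 *\<^sub>R c) = 0" "\<alpha>1 \<noteq> \<alpha>2"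
    using assms(8,11) \<alpha>1 \<alpha>2 a0(2) by (auto simp: K point_of_in_zero_locus_iff[OF f(1)])
  have B: "f (c + \<beta>1 *\<^sub>R a) (c + \<beta>1 *\<^sub>R a) = 0" "f (c + \<beta>2 *\<^sub>R a) (c + \<beta>2 *\<^sub>R a) = 0" "\<beta>1 \<noteq> \<beta>2"
    using assms(8,11) \<beta>1 \<beta>2 b0(2) by (auto simp: K point_of_in_zero_locus_iff[OF f(1)])
  have C: "f (a + \<gamma>1 *\<^sub>R b) (a + \<gamma>1 *\<^sub>R b) = 0" "f (a + \<gamma>2 *\<^sub>R b) (a + \<gamma>2 *\<^sub>R b) = 0" "\<gamma>1 \<noteq> \<gamma>2"
    using assms(8,11) \<gamma>1 \<gamma>2 c0(2) by (auto simp: K point_of_in_zero_locus_iff[OF f(1)])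
  note abc' = independent_triple_cycle[OF abc]
  note abc'' = independent_triple_cycle[OF abc']
  have vert: "f a a \<noteq> 0" "f b b \<noteq> 0" "f c c \<noteq> 0"
    using vertex_not_on_conic[OF f abc A(1) \<alpha>1(1) B C \<gamma>1(1) \<gamma>2(1)]
      vertex_not_on_conic[OF f abc' B(1) \<beta>1(1) C A \<alpha>1(1) \<alpha>2(1)]
      vertex_not_on_conic[OF f abc'' C(1) \<gamma>1(1) A B \<beta>1(1) \<beta>2(1)] by auto
  note A' = A(2,1) A(3)[symmetric] and B' = B(2,1) B(3)[symmetric] and C' = C(2,1) C(3)[symmetric]
  note D = assms(12,13)[unfolded K vA] and E = assms(14,15)[unfolded K vB]
    and F = assms(16,17)[unfolded K vC]
  note pA = \<alpha>1(2) \<alpha>2(2) and pB = \<beta>1(2) \<beta>2(2) and pC = \<gamma>1(2) \<gamma>2(2)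
  have A3: "meet_at C1 B2 E1 F2 A3" and A4: "meet_at B1 C2 F1 E2 A4"
    and B3: "meet_at A1 C2 F1 D2 B3" and B4: "meet_at C1 A2 D1 F2 B4"
    and C3: "meet_at B1 A2 D1 E2 C3" and C4: "meet_at A1 B2 E1 D2 C4"
    and D3: "meet_at B1 C1 E2 F2 D3" and D4: "meet_at B2 C2 E1 F1 D4"
    and E3: "meet_at A1 C1 D2 F2 E3" and E4: "meet_at A2 C2 D1 F1 E4"
    and F3: "meet_at A1 B1 D2 E2 F3" and F4: "meet_at A2 B2 D1 E1 F4"
    by fact+
  note swap = meet_at_commute
  have "coconic {D3, D4, E3, E4, F3, F4}"
    by (rule sextuple_coconic[OF f(1) abc vert A B C pA pB pC D E F D3 D4 E3 E4 F3 F4])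
  \<comment> \<open>Exchange \<open>C1, F1\<close> with \<open>C2, F2\<close>; below, \<open>B1, E1\<close> with \<open>B2, E2\<close>, and \<open>A1, D1\<close> with \<open>A2, D2\<close>.\<close>
  moreover have "coconic {A4, A3, B3, B4, F3, F4}"
    by (rule sextuple_coconic[OF f(1) abc vert A B C' pA pB pC(2,1) D E F(2,1)
          swap(2)[OF A4] swap(1)[OF A3] swap(2)[OF B3] swap(1)[OF B4] F3 F4])
  moreover have "coconic {A3, A4, E3, E4, C4, C3}"
    by (rule sextuple_coconic[OF f(1) abc vert A B' C pA pB(2,1) pC D E(2,1) F
          swap(1)[OF A3] swap(2)[OF A4] E3 E4 swap(2)[OF C4] swap(1)[OF C3]])
  moreover have "coconic {D3, D4, B4, B3, C3, C4}"
    by (rule sextuple_coconic[OF f(1) abc vert A' B C pA(2,1) pB pC D(2,1) E F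
          D3 D4 swap(1)[OF B4] swap(2)[OF B3] swap(1)[OF C3] swap(2)[OF C4]])
  ultimately show ?thesis
    by (simp add: insert_commute)
qed

end
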